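(* For every integer $\ell\ge1$ there is a constant $\tilde C_\ell>0$ depending on $\ell$ but not on $\eta$ such that for all $x\in\mathbb R^d$, $0\le s<1$ and $0<\eta<1$, $$\mathbb E|X^x_s-x|^{2\ell}\le\tilde C_\ell(1+V^\ell(x))s^\ell,\qquad\mathbb E|X^x_\eta-\tilde X^{\eta,x}_1|^{2\ell}\le\tilde C_\ell(1+V^\ell(x))\eta^{3\ell}.$$
   Context: Fix $d\ge1$, $\alpha>0$, $\beta\in\mathbb R$, $p\in\mathbb R^d$ with nonnegative entries summing to $1$, $\mathrm e=(1,\dots,1)'$, positive rates $v$, a sub-stochastic matrix $P$ with $P_{ii}=0$ and $I-P$ invertible; $R=(I-P')\mathrm{diag}(v)$, assume $\mathrm e'R^{-1}p=1$, $\gamma=R^{-1}p$. $\sigma$ is a $d\times d$ matrix with $\sigma\sigma'=\mathrm{diag}(p)c_a^2+H^{(0)}+\sum_{k}\gamma_kv_kH^{(k)}+(I-P')\mathrm{diag}(v)\mathrm{diag}(\gamma)(I-P)$, $c_a^2>0$, $H^{(k)}_{ii}=P_{ki}(1-P_{ki})$, $H^{(k)}_{ij}=-P_{ki}P_{kj}$ ($i\ne j$), $H^{(0)}_{ii}=p_i(1-p_i)$, $H^{(0)}_{ij}=-p_ip_j$ ($i\ne j$), and $\xi'\sigma\sigma'\xi\ge c\,\xi'\xi$ for some $c>0$. $g(x)=-\beta p-Rx+(R-\alpha I)p(\mathrm e'x)^+$; $X^x$ solves $\mathrm dX_t=g(X_t)\mathrm dt+\sigma\mathrm dB_t$, $X_0=x$,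 and the Euler–Maruyama step is coupled with the same Brownian motion: $\tilde X^{\eta,x}_1=x+g(x)\eta+\sigma B_\eta$. $V$ is the Lyapunov function $V(y)=(\mathrm e'y)^2+\kappa[y-p\phi(\mathrm e'y)]'\tilde Q[y-p\phi(\mathrm e'y)]+\hat c_2$ of Dieker–Gao type: $\tilde Q$ positive definite with $\sum|\tilde Q_{ij}|=1$, $\tilde Q(-R)+(-R)'\tilde Q<0$, $\tilde Q(-(I-p\mathrm e')R)+(-R'(I-\mathrm ep'))\tilde Q\le0$; $\phi(z)=z$ ($z\ge0$), $-\frac12$ ($z\le-1$), $-\frac12z^4-z^3+z$ ($-1<z<0$); $\kappa>0$ chosen so that $\mathcal A\tilde V\le-c_1\tilde V+\check c_1$ for the function $\tilde V=V-\hat c_2$ (with $\mathcal A\varphi=\langle\nabla\varphi,g\rangle+\frac12\sum(\sigma\sigma')_{ij}\partial_{ij}\varphi$, $c_1>0$); $\hat c_2>0$ is such that $\hat c_1|y|^2-\hat c_2\le\tilde V(y)\le\hat C_1|y|^2+\hat C_2$ for positive constants $\hat c_1,\hat C_1,\hat C_2$. *)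

theory Defs
  imports "HOL-Analysis.Analysis" "HOL-Probability.Probability"
begin

text \<open>Diagonal matrix from a vector, all-ones vector.\<close>
definition diagm :: "real^'d \<Rightarrow> real^'d^'d" where
  "diagm v = (\<chi> i j. if i = j then v $ i else 0)"

definition outerp :: "real^'d \<Rightarrow> real^'d \<Rightarrow> real^'d^'d" where
  "outerp u w = (\<chi> i j. u $ i * w $ j)"

definition onevec :: "real^'d" where
  "onevec = (\<chi> i. 1)"

text \<open>H^(0) and H^(k) from the covariance formula.\<close>
definition H0 :: "real^'d \<Rightarrow> real^'d^'d" where
  "H0 p = (\<chi> i j. if i = j then p $ i * (1 - p $ i) else - (p $ i * p $ j))"

definition Hk :: "real^'d^'d \<Rightarrow> 'd \<Rightarrow> real^'d^'d" where
  "Hk P k = (\<chi> i j. if i = j then P $ k $ i * (1 - P $ k $ i) else - (P $ k $ i * P $ k $ j))"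

text \<open>The drift g.\<close>
definition drift :: "real \<Rightarrow> real \<Rightarrow> real^'d \<Rightarrow> real^'d^'d \<Rightarrow> real^'d \<Rightarrow> real^'d" where
  "drift \<alpha> \<beta> p R x = - (\<beta> *\<^sub>R p) - R *v x + max 0 (onevec \<bullet> x) *\<^sub>R ((R - \<alpha> *\<^sub>R mat 1) *v p)"

text \<open>The smoothing function phi of Dieker--Gao.\<close>
definition phi :: "real \<Rightarrow> real" where
  "phi z = (if z \<ge> 0 then z else if z \<le> -1 then - 1/2 else - (1/2) * z^4 - z^3 + z)"

text \<open>Lyapunov function V (with additive constant c2).\<close>
definition lyapV :: "real^'d^'d \<Rightarrow> real \<Rightarrow> real \<Rightarrow> real^'d \<Rightarrow> real^'d \<Rightarrow> real" where
  "lyapV Q \<kappa> c2 p y =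
     (let w = y - phi (onevec \<bullet> y) *\<^sub>R p in (onevec \<bullet> y)\<^sup>2 + \<kappa> * (w \<bullet> (Q *v w)) + c2)"

text \<open>Partial derivatives and the generator A of the diffusion.\<close>
definition pderiv_i :: "'d \<Rightarrow> (real^'d \<Rightarrow> real) \<Rightarrow> real^'d \<Rightarrow> real" where
  "pderiv_i i f y = deriv (\<lambda>t. f (y + t *\<^sub>R axis i 1)) 0"

definition generator :: "(real^'d \<Rightarrow> real^'d) \<Rightarrow> real^'d^'d \<Rightarrow> (real^'d \<Rightarrow> real) \<Rightarrow> real^'d \<Rightarrow> real" where
  "generator g S f y =
     (\<Sum>i\<in>UNIV. pderiv_i i f y * g y $ i)
     + 1/2 * (\<Sum>i\<in>UNIV. \<Sum>j\<in>UNIV. S $ i $ j * pderiv_i i (pderiv_i j f) y)"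

text \<open>Standard d-dimensional Brownian motion on a probability space M
  (coordinates are independent standard one-dimensional Brownian motions):
  B_0 = 0, continuous paths, and for any times 0 <= t_0 < ... < t_n the
  coordinate increments over the successive intervals are independent
  centered normals with variance equal to the interval length.\<close>
definition brownian_motion :: "'a measure \<Rightarrow> (real \<Rightarrow> 'a \<Rightarrow> real^'d) \<Rightarrow> bool" where
  "brownian_motion M B \<longleftrightarrow>
     prob_space M \<and>
     (\<forall>t\<ge>0. B t \<in> borel_measurable M) \<and>
     (\<forall>\<omega>\<in>space M. B 0 \<omega> = 0 \<and> continuous_on {0..} (\<lambda>t. B t \<omega>)) \<and>
     (\<forall>(n::nat) (t::nat \<Rightarrow> real). 0 \<le> t 0 \<and> (\<forall>k<n. t k < t (Suc k)) \<longrightarrow>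
        prob_space.indep_vars M (\<lambda>_. borel)
          (\<lambda>(k, i) \<omega>. B (t (Suc k)) \<omega> $ i - B (t k) \<omega> $ i) ({..<n} \<times> (UNIV :: 'd set)) \<and>
        (\<forall>k<n. \<forall>i::'d. distributed M lborel (\<lambda>\<omega>. B (t (Suc k)) \<omega> $ i - B (t k) \<omega> $ i)
            (\<lambda>z. ennreal (normal_density 0 (sqrt (t (Suc k) - t k)) z))))"

text \<open>X x is the (pathwise) solution of dX = g(X) dt + sigma dB, X_0 = x.\<close>
definition solves_sde :: "'a measure \<Rightarrow> (real^'d \<Rightarrow> real^'d) \<Rightarrow> real^'d^'d \<Rightarrow> (real \<Rightarrow> 'a \<Rightarrow> real^'d)
    \<Rightarrow> real^'d \<Rightarrow> (real \<Rightarrow> 'a \<Rightarrow> real^'d) \<Rightarrow> bool" where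
  "solves_sde M g \<sigma> B x X \<longleftrightarrow>
     (\<forall>t\<ge>0. X t \<in> borel_measurable M) \<and>
     (\<forall>\<omega>\<in>space M. continuous_on {0..} (\<lambda>t. X t \<omega>) \<and>
        (\<forall>t\<ge>0. X t \<omega> = x + integral {0..t} (\<lambda>r. g (X r \<omega>)) + \<sigma> *v B t \<omega>))"

end

theory Submission
  imports Defs
begin

text \<open>
  Along every sample path, X^x solves the integral equation
  X_t = x + \<integral>_0^t g(X_r) dr + \<sigma> B_t with a globally Lipschitz drift g. Gronwall's
  inequality therefore bounds |X_t - x| by a multiple of t |g(x)| + \<integral>_0^t |B_r| dr + |B_t|,
  and the Euler error X_t - x - t g(x) - \<sigma> B_t = \<integral>_0^t (g(X_r) - g(x)) dr by a multiple of
  t^2 |g(x)| + \<integral>_0^t |B_r| dr. Gaussian scaling gives E |B_t|^{2l} = O(t^l), and Jensen's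
  inequality in time together with Fubini gives E (\<integral>_0^t |B_r| dr)^{2l} = O(t^{3l}).
  Finally |g(x)|^{2l} = O(1 + V(x)^l) since g grows linearly and V at least quadratically.
  Only the Lipschitz property of g, the lower quadratic bound on V and the pathwise
  description of X and B are used.
\<close>

section \<open>Elementary inequalities\<close>

lemma power_sum_le_card_power:
  fixes a :: "'i \<Rightarrow> real"
  assumes fin: "finite I" and ne: "I \<noteq> {}" and nonneg: "\<And>i. i \<in> I \<Longrightarrow> 0 \<le> a i"
  shows "(\<Sum>i\<in>I. a i) ^ n \<le> real (card I) ^ n * (\<Sum>i\<in>I. a i ^ n)"
proof -
  have "Max (a ` I) \<in> a ` I"
    using fin ne by (intro Max_in) auto
  then obtain j where j: "j \<in> I" "a j = Max (a ` I)"
    by (metis imageE)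
  then have max: "\<And>i. i \<in> I \<Longrightarrow> a i \<le> a j"
    using fin by auto
  have "(\<Sum>i\<in>I. a i) ^ n \<le> (real (card I) * a j) ^ n"
    using sum_bounded_above[of I a "a j"] max nonneg by (intro power_mono sum_nonneg) auto
  also have "\<dots> = real (card I) ^ n * a j ^ n"
    by (simp add: power_mult_distrib)
  also have "\<dots> \<le> real (card I) ^ n * (\<Sum>i\<in>I. a i ^ n)"
    using j nonneg fin by (intro mult_left_mono member_le_sum) auto
  finally show ?thesis .
qed

lemma power_add_le:
  fixes a b :: real
  assumes "0 \<le> a" "0 \<le> b"
  shows "(a + b) ^ n \<le> 2 ^ n * (a ^ n + b ^ n)"
proof -
  have "(\<Sum>i\<in>{0, 1 :: nat}. [a, b] ! i) ^ n
      \<le> real (card {0, 1 :: nat}) ^ n * (\<Sum>i\<in>{0, 1 :: nat}. ([a, b] ! i) ^ n)"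
    using assms by (intro power_sum_le_card_power) auto
  then show ?thesis by simp
qed

lemma power_add3_le:
  fixes a b c :: real
  assumes "0 \<le> a" "0 \<le> b" "0 \<le> c"
  shows "(a + b + c) ^ n \<le> 3 ^ n * (a ^ n + b ^ n + c ^ n)"
proof -
  have "(\<Sum>i\<in>{0, 1, 2 :: nat}. [a, b, c] ! i) ^ n
      \<le> real (card {0, 1, 2 :: nat}) ^ n * (\<Sum>i\<in>{0, 1, 2 :: nat}. ([a, b, c] ! i) ^ n)"
    using assms by (intro power_sum_le_card_power) auto
  then show ?thesis by (simp add: add.assoc)
qed

lemma norm_power_le_sum_abs_power:
  fixes v :: "real^'d"
  shows "norm v ^ n \<le> real CARD('d) ^ n * (\<Sum>i\<in>UNIV. \<bar>v $ i\<bar> ^ n)"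
proof -
  have "norm v ^ n \<le> (\<Sum>i\<in>UNIV. \<bar>v $ i\<bar>) ^ n"
    by (intro power_mono norm_le_l1_cart) auto
  also have "\<dots> \<le> real CARD('d) ^ n * (\<Sum>i\<in>UNIV. \<bar>v $ i\<bar> ^ n)"
    by (rule power_sum_le_card_power) auto
  finally show ?thesis .
qed

lemma mult_power_le_mult_power:
  fixes a A t :: real
  assumes "0 \<le> t" "t \<le> 1" "k \<le> e" "0 \<le> a" "a \<le> A"
  shows "a * t ^ e \<le> A * t ^ k"
  using assms by (intro mult_mono power_decreasing) auto

lemma moment_bound_collect:
  fixes t y a A1 A2 A3 C :: real
  assumes t: "0 \<le> t" "t \<le> 1" and y: "0 \<le> y" and A: "0 \<le> A1" "0 \<le> A2" "0 \<le> A3"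
    and e: "k \<le> e1" "k \<le> e2" "k \<le> e3" and a: "0 \<le> a" and C: "a * (A1 + A2 + A3) \<le> C"
  shows "a * (A1 * y ^ n * t ^ e1 + A2 * t ^ e2 + A3 * t ^ e3) \<le> C * (1 + y ^ n) * t ^ k"
proof -
  have W: "1 \<le> 1 + y ^ n"
    using y by simp
  have le_W: "A \<le> A * (1 + y ^ n)" if "0 \<le> A" for A :: real
    using mult_left_mono[OF W that] by simp
  have "A1 * y ^ n * t ^ e1 \<le> A1 * (1 + y ^ n) * t ^ k"
    using t y A e by (intro mult_power_le_mult_power mult_left_mono) auto
  moreover have "A2 * t ^ e2 \<le> A2 * (1 + y ^ n) * t ^ k"
    using t A e by (intro mult_power_le_mult_power le_W) auto
  moreover have "A3 * t ^ e3 \<le> A3 * (1 + y ^ n) * t ^ k"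
    using t A e by (intro mult_power_le_mult_power le_W) auto
  ultimately have "A1 * y ^ n * t ^ e1 + A2 * t ^ e2 + A3 * t ^ e3 \<le> (A1 + A2 + A3) * ((1 + y ^ n) * t ^ k)"
    by (simp add: algebra_simps)
  then have "a * (A1 * y ^ n * t ^ e1 + A2 * t ^ e2 + A3 * t ^ e3) \<le> a * (A1 + A2 + A3) * ((1 + y ^ n) * t ^ k)"
    using a by (simp add: mult.assoc mult_left_mono)
  also have "\<dots> \<le> C * ((1 + y ^ n) * t ^ k)"
    using C t y by (intro mult_right_mono) auto
  finally show ?thesis
    by (simp add: mult.assoc)
qed

text \<open>The tangent line of b \<mapsto> b^n at a lies below the graph.\<close>
lemma power_tangent_le:
  fixes a b :: real
  assumes "0 \<le> a" "0 \<le> b" "1 \<le> n"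
  shows "real n * a ^ (n - 1) * b - (real n - 1) * a ^ n \<le> b ^ n"
proof (cases "a = 0")
  case True
  then show ?thesis using assms by (cases n; cases "n - 1") auto
next
  case False
  then have a: "0 < a" using assms by auto
  have "a ^ n * (1 + real n * (b / a - 1)) \<le> a ^ n * (1 + (b / a - 1)) ^ n"
    using a assms by (intro mult_left_mono Bernoulli_inequality) auto
  also have "\<dots> = b ^ n"
    using a by (simp add: power_divide)
  also have "a ^ n * (1 + real n * (b / a - 1)) = real n * (a ^ n / a) * b - (real n - 1) * a ^ n"
    using a by (simp add: field_simps)
  also have "a ^ n / a = a ^ (n - 1)"
    using a assms by (simp add: power_diff)
  finally show ?thesis .
qed

text \<open>Jensen's inequality for the uniform distribution on [0, t], obtained by integrating the
  tangent line inequality at the mean value a = (1/t) \<integral>_0^t h.\<close>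
lemma power_integral_le:
  fixes h :: "real \<Rightarrow> real"
  assumes ch: "continuous_on {0..t} h" and h_nonneg: "\<And>u. u \<in> {0..t} \<Longrightarrow> 0 \<le> h u"
    and "1 \<le> n"
  shows "integral {0..t} h ^ n \<le> t ^ (n - 1) * integral {0..t} (\<lambda>u. h u ^ n)"
proof (cases "0 < t")
  case False
  then have "integral {0..t} h = 0" "integral {0..t} (\<lambda>u. h u ^ n) = 0"
    by (cases "t = 0"; simp)+
  then show ?thesis using \<open>1 \<le> n\<close> by (simp add: power_0_left)
next
  case t: True
  define a where "a = integral {0..t} h / t"
  have int_ch: "(\<lambda>u. c * h u) integrable_on {0..t}" for c
    by (intro integrable_continuous_real continuous_intros ch)
  have int_hn: "(\<lambda>u. h u ^ n) integrable_on {0..t}"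
    by (intro integrable_continuous_real continuous_intros ch)
  have "0 \<le> a"
    unfolding a_def using t h_nonneg int_ch[of 1] by (intro divide_nonneg_pos integral_nonneg) auto
  then have "integral {0..t} (\<lambda>u. real n * a ^ (n - 1) * h u - (real n - 1) * a ^ n)
      \<le> integral {0..t} (\<lambda>u. h u ^ n)"
    using h_nonneg \<open>1 \<le> n\<close> int_ch int_hn by (intro integral_le power_tangent_le integrable_diff) auto
  also have "integral {0..t} (\<lambda>u. real n * a ^ (n - 1) * h u - (real n - 1) * a ^ n)
      = real n * a ^ (n - 1) * (a * t) - t * ((real n - 1) * a ^ n)"
    using t int_ch by (subst integral_diff) (auto simp: a_def)
  also have "\<dots> = t * a ^ n"
    using \<open>1 \<le> n\<close> by (cases n) (auto simp: algebra_simps)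
  finally have "t ^ (n - 1) * (t * a ^ n) \<le> t ^ (n - 1) * integral {0..t} (\<lambda>u. h u ^ n)"
    using t by (intro mult_left_mono) auto
  moreover have "t ^ (n - 1) * (t * a ^ n) = integral {0..t} h ^ n"
    unfolding a_def using t \<open>1 \<le> n\<close> by (cases n) (auto simp: power_divide field_simps)
  ultimately show ?thesis by simp
qed

section \<open>Gronwall's inequality and integral equations\<close>

lemma gronwall_integral:
  fixes D f :: "real \<Rightarrow> real"
  assumes cD: "continuous_on {0..r} D" and cf: "continuous_on {0..r} f"
    and L: "0 \<le> L" and r: "0 \<le> r" and f_nonneg: "\<And>u. u \<in> {0..r} \<Longrightarrow> 0 \<le> f u"
    and D_le: "\<And>u. u \<in> {0..r} \<Longrightarrow> D u \<le> L * integral {0..u} D + f u"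
  shows "integral {0..r} D \<le> exp (L * r) * integral {0..r} f"
proof -
  define \<psi> where "\<psi> u = exp (- L * u) * integral {0..u} D - integral {0..u} f" for u
  have "\<psi> r \<le> \<psi> 0"
  proof (rule DERIV_nonpos_imp_decreasing_open[OF r])
    show "continuous_on {0..r} \<psi>"
      unfolding \<psi>_def
      by (intro continuous_intros indefinite_integral_continuous_1 integrable_continuous_real cD cf)
    fix t assume t: "0 < t" "t < r"
    then have t_int: "t \<in> interior {0..r}" and t_in: "t \<in> {0..r}" by auto
    have dD: "((\<lambda>u. integral {0..u} D) has_real_derivative D t) (at t)"
      using integral_has_real_derivative[OF cD t_in] at_within_interior[OF t_int] by simp
    have df: "((\<lambda>u. integral {0..u} f) has_real_derivative f t) (at t)"
      using integral_has_real_derivative[OF cf t_in] at_within_interior[OF t_int] by simp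
    have "(\<psi> has_real_derivative exp (- L * t) * (D t - L * integral {0..t} D) - f t) (at t)"
      unfolding \<psi>_def by (auto intro!: derivative_eq_intros dD df simp: algebra_simps)
    moreover have "exp (- L * t) * (D t - L * integral {0..t} D) \<le> exp (- L * t) * f t"
      using D_le[OF t_in] by (intro mult_left_mono) auto
    moreover have "exp (- L * t) * f t \<le> f t"
      using f_nonneg[OF t_in] L t by (intro mult_left_le_one_le) auto
    ultimately show "\<exists>y. (\<psi> has_real_derivative y) (at t) \<and> y \<le> 0"
      by (intro exI conjI) (assumption, linarith)
  qed
  then have "exp (- L * r) * integral {0..r} D \<le> integral {0..r} f"
    unfolding \<psi>_def by simp
  then show ?thesis
    by (simp add: exp_minus field_simps)
qed

lemma integral_equation_increment_eq:
  fixes Y c :: "real \<Rightarrow> 'v::euclidean_space"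
  assumes cg: "continuous_on UNIV g" and cY: "continuous_on {0..t} Y" and t: "0 \<le> t"
    and eq: "Y t = x + integral {0..t} (\<lambda>r. g (Y r)) + c t"
  shows "Y t - x = integral {0..t} (\<lambda>r. g (Y r) - g x) + t *\<^sub>R g x + c t"
proof -
  have "(\<lambda>r. g (Y r)) integrable_on {0..t}"
    by (intro integrable_continuous_real continuous_on_compose2[OF cg cY]) auto
  then have "integral {0..t} (\<lambda>r. g (Y r) - g x) = integral {0..t} (\<lambda>r. g (Y r)) - t *\<^sub>R g x"
    using t by (subst integral_diff) auto
  then show ?thesis
    using eq by (simp add: algebra_simps)
qed

context
  fixes Y c :: "real \<Rightarrow> 'v::euclidean_space" and g :: "'v \<Rightarrow> 'v" and L t :: real and x :: 'v
  assumes lip: "L-lipschitz_on UNIV g"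
    and cY: "continuous_on {0..t} Y" and cc: "continuous_on {0..t} c" and t: "0 \<le> t"
    and eq: "\<And>r. r \<in> {0..t} \<Longrightarrow> Y r = x + integral {0..r} (\<lambda>u. g (Y u)) + c r"
begin

lemma integral_equation_drift_integral_le:
  assumes r: "r \<in> {0..t}"
  shows "norm (integral {0..r} (\<lambda>u. g (Y u) - g x)) \<le> L * integral {0..r} (\<lambda>u. norm (Y u - x))"
proof -
  have cYr: "continuous_on {0..r} Y"
    using r by (auto intro: continuous_on_subset[OF cY])
  have "norm (integral {0..r} (\<lambda>u. g (Y u) - g x)) \<le> integral {0..r} (\<lambda>u. L * norm (Y u - x))"
    using lipschitz_onD[OF lip] cYr unfolding dist_norm
    by (intro integral_norm_bound_integral integrable_continuous_real continuous_intros
        continuous_on_compose2[OF lipschitz_on_continuous_on[OF lip] cYr]) auto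
  then show ?thesis by simp
qed

lemma integral_equation_gronwall_premise:
  assumes r: "r \<in> {0..t}"
  shows "norm (Y r - x) \<le> L * integral {0..r} (\<lambda>u. norm (Y u - x)) + (r * norm (g x) + norm (c r))"
proof -
  have "Y r - x = integral {0..r} (\<lambda>u. g (Y u) - g x) + r *\<^sub>R g x + c r"
    using r eq[OF r] lipschitz_on_continuous_on[OF lip]
    by (intro integral_equation_increment_eq) (auto intro: continuous_on_subset[OF cY])
  then have "norm (Y r - x) \<le> norm (integral {0..r} (\<lambda>u. g (Y u) - g x)) + norm (r *\<^sub>R g x) + norm (c r)"
    by (metis norm_triangle_le norm_triangle_ineq add_right_mono)
  then show ?thesis
    using integral_equation_drift_integral_le[OF r] r by simp
qed

lemma integral_equation_drift_bound:
  "norm (integral {0..t} (\<lambda>r. g (Y r) - g x))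
     \<le> L * exp (L * t) * (t\<^sup>2 * norm (g x) + integral {0..t} (\<lambda>u. norm (c u)))"
proof -
  have L: "0 \<le> L"
    using lip by (rule lipschitz_on_nonneg)
  define f where "f u = u * norm (g x) + norm (c u)" for u
  have "integral {0..t} f \<le> integral {0..t} (\<lambda>u. t * norm (g x) + norm (c u))"
    unfolding f_def
    by (intro integral_le integrable_continuous_real continuous_intros cc) (auto intro: mult_right_mono)
  also have "\<dots> = t\<^sup>2 * norm (g x) + integral {0..t} (\<lambda>u. norm (c u))"
    using t by (subst integral_add) (auto intro!: integrable_continuous_real continuous_intros cc
        simp: power2_eq_square)
  finally have int_f: "integral {0..t} f \<le> t\<^sup>2 * norm (g x) + integral {0..t} (\<lambda>u. norm (c u))" .
  have "norm (integral {0..t} (\<lambda>r. g (Y r) - g x)) \<le> L * integral {0..t} (\<lambda>u. norm (Y u - x))"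
    using t by (intro integral_equation_drift_integral_le) auto
  also have "\<dots> \<le> L * (exp (L * t) * integral {0..t} f)"
    using L t integral_equation_gronwall_premise unfolding f_def
    by (intro mult_left_mono gronwall_integral continuous_intros cY cc) auto
  also have "\<dots> \<le> L * exp (L * t) * (t\<^sup>2 * norm (g x) + integral {0..t} (\<lambda>u. norm (c u)))"
    using L int_f by (simp add: mult.assoc mult_left_mono)
  finally show ?thesis .
qed

lemma integral_equation_increment_bound:
  "norm (Y t - x) \<le> L * exp (L * t) * (t\<^sup>2 * norm (g x) + integral {0..t} (\<lambda>u. norm (c u)))
                     + t * norm (g x) + norm (c t)"
proof -
  have "Y t - x = integral {0..t} (\<lambda>r. g (Y r) - g x) + t *\<^sub>R g x + c t"
    using t eq[of t] lipschitz_on_continuous_on[OF lip] cY by (intro integral_equation_increment_eq) auto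
  then have "norm (Y t - x) \<le> norm (integral {0..t} (\<lambda>r. g (Y r) - g x)) + norm (t *\<^sub>R g x) + norm (c t)"
    by (metis norm_triangle_le norm_triangle_ineq add_right_mono)
  then show ?thesis
    using integral_equation_drift_bound t by simp
qed

lemma integral_equation_euler_error_bound:
  "norm (Y t - (x + t *\<^sub>R g x + c t))
     \<le> L * exp (L * t) * (t\<^sup>2 * norm (g x) + integral {0..t} (\<lambda>u. norm (c u)))"
proof -
  have "Y t - x = integral {0..t} (\<lambda>r. g (Y r) - g x) + t *\<^sub>R g x + c t"
    using t eq[of t] lipschitz_on_continuous_on[OF lip] cY by (intro integral_equation_increment_eq) auto
  then have "Y t - (x + t *\<^sub>R g x + c t) = integral {0..t} (\<lambda>r. g (Y r) - g x)"
    by (simp add: algebra_simps)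
  then show ?thesis
    using integral_equation_drift_bound by simp
qed

end

section \<open>Moments of Brownian motion\<close>

lemma (in prob_space) nn_integral_power_le_sum3:
  fixes D Y Z :: "'a \<Rightarrow> real"
  assumes Ym: "(\<lambda>\<omega>. ennreal (Y \<omega> ^ n)) \<in> borel_measurable M"
    and Zm: "(\<lambda>\<omega>. ennreal (Z \<omega> ^ n)) \<in> borel_measurable M"
    and D_le: "\<And>\<omega>. \<omega> \<in> space M \<Longrightarrow>
                 0 \<le> D \<omega> \<and> D \<omega> \<le> a + b * Y \<omega> + c * Z \<omega> \<and> 0 \<le> Y \<omega> \<and> 0 \<le> Z \<omega>"
    and EY: "(\<integral>\<^sup>+\<omega>. ennreal (Y \<omega> ^ n) \<partial>M) \<le> ennreal mY"
    and EZ: "(\<integral>\<^sup>+\<omega>. ennreal (Z \<omega> ^ n) \<partial>M) \<le> ennreal mZ"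
    and nonneg: "0 \<le> a" "0 \<le> b" "0 \<le> c" "0 \<le> mY" "0 \<le> mZ"
  shows "(\<integral>\<^sup>+\<omega>. ennreal (D \<omega> ^ n) \<partial>M) \<le> ennreal (3 ^ n * (a ^ n + b ^ n * mY + c ^ n * mZ))"
proof -
  have "(\<integral>\<^sup>+\<omega>. ennreal (D \<omega> ^ n) \<partial>M)
      \<le> (\<integral>\<^sup>+\<omega>. ennreal (3 ^ n * a ^ n) + ennreal (3 ^ n * b ^ n) * ennreal (Y \<omega> ^ n)
                 + ennreal (3 ^ n * c ^ n) * ennreal (Z \<omega> ^ n) \<partial>M)"
  proof (rule nn_integral_mono)
    fix \<omega> assume \<omega>: "\<omega> \<in> space M"
    have "D \<omega> ^ n \<le> (a + b * Y \<omega> + c * Z \<omega>) ^ n"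
      using D_le[OF \<omega>] by (intro power_mono) auto
    also have "\<dots> \<le> 3 ^ n * (a ^ n + (b * Y \<omega>) ^ n + (c * Z \<omega>) ^ n)"
      using D_le[OF \<omega>] nonneg by (intro power_add3_le) auto
    finally have "ennreal (D \<omega> ^ n) \<le> ennreal (3 ^ n * a ^ n + 3 ^ n * b ^ n * Y \<omega> ^ n + 3 ^ n * c ^ n * Z \<omega> ^ n)"
      by (intro ennreal_leI) (simp add: power_mult_distrib algebra_simps)
    also have "\<dots> = ennreal (3 ^ n * a ^ n) + ennreal (3 ^ n * b ^ n) * ennreal (Y \<omega> ^ n)
                 + ennreal (3 ^ n * c ^ n) * ennreal (Z \<omega> ^ n)"
      using D_le[OF \<omega>] nonneg by (simp add: ennreal_mult mult.assoc)
    finally show "ennreal (D \<omega> ^ n) \<le> ennreal (3 ^ n * a ^ n) + ennreal (3 ^ n * b ^ n) * ennreal (Y \<omega> ^ n)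
                 + ennreal (3 ^ n * c ^ n) * ennreal (Z \<omega> ^ n)" .
  qed
  also have "\<dots> = ennreal (3 ^ n * a ^ n) + ennreal (3 ^ n * b ^ n) * (\<integral>\<^sup>+\<omega>. ennreal (Y \<omega> ^ n) \<partial>M)
                 + ennreal (3 ^ n * c ^ n) * (\<integral>\<^sup>+\<omega>. ennreal (Z \<omega> ^ n) \<partial>M)"
    using Ym Zm by (simp add: nn_integral_add nn_integral_cmult emeasure_space_1)
  also have "\<dots> \<le> ennreal (3 ^ n * a ^ n) + ennreal (3 ^ n * b ^ n) * ennreal mY
                 + ennreal (3 ^ n * c ^ n) * ennreal mZ"
    by (intro add_mono mult_left_mono EY EZ order_refl) auto
  also have "\<dots> = ennreal (3 ^ n * a ^ n + 3 ^ n * b ^ n * mY + 3 ^ n * c ^ n * mZ)"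
    using nonneg by (simp add: ennreal_plus[symmetric] ennreal_mult[symmetric] del: ennreal_plus)
  also have "\<dots> = ennreal (3 ^ n * (a ^ n + b ^ n * mY + c ^ n * mZ))"
    by (simp add: algebra_simps)
  finally show ?thesis .
qed

lemma brownian_motionD:
  assumes "brownian_motion M B"
  shows brownian_motion_prob_space: "prob_space M"
    and brownian_motion_measurable: "0 \<le> t \<Longrightarrow> B t \<in> borel_measurable M"
    and brownian_motion_zero: "\<omega> \<in> space M \<Longrightarrow> B 0 \<omega> = 0"
    and brownian_motion_continuous: "\<omega> \<in> space M \<Longrightarrow> continuous_on {0..} (\<lambda>t. B t \<omega>)"
  using assms unfolding brownian_motion_def by auto

lemma brownian_motion_continuous_interval:
  assumes "brownian_motion M B" "\<omega> \<in> space M"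
  shows "continuous_on {0..t} (\<lambda>u. B u \<omega>)"
  using brownian_motion_continuous[OF assms] by (rule continuous_on_subset) auto

lemma brownian_motion_integral_norm_nonneg:
  assumes "brownian_motion M B" "\<omega> \<in> space M"
  shows "0 \<le> integral {0..t} (\<lambda>u. norm (B u \<omega>))"
  using brownian_motion_continuous_interval[OF assms]
  by (intro integral_nonneg integrable_continuous_real continuous_intros) auto

lemma brownian_motion_increment_distributed:
  fixes B :: "real \<Rightarrow> 'a \<Rightarrow> real^'d"
  assumes BM: "brownian_motion M B" and u: "0 < u"
  shows "distributed M lborel (\<lambda>\<omega>. B u \<omega> $ i - B 0 \<omega> $ i) (\<lambda>z. ennreal (normal_density 0 (sqrt u) z))"
proof -
  define t where "t k = (if k = 0 then 0 else u)" for k :: nat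
  have increments: "\<And>n t. 0 \<le> t 0 \<Longrightarrow> (\<forall>k<n. t k < t (Suc k)) \<Longrightarrow>
      \<forall>k<n. \<forall>i::'d. distributed M lborel (\<lambda>\<omega>. B (t (Suc k)) \<omega> $ i - B (t k) \<omega> $ i)
        (\<lambda>z. ennreal (normal_density 0 (sqrt (t (Suc k) - t k)) z))"
    using BM unfolding brownian_motion_def by blast
  have "\<forall>k<1. \<forall>i::'d. distributed M lborel (\<lambda>\<omega>. B (t (Suc k)) \<omega> $ i - B (t k) \<omega> $ i)
      (\<lambda>z. ennreal (normal_density 0 (sqrt (t (Suc k) - t k)) z))"
    by (rule increments) (auto simp: t_def u)
  then show ?thesis
    by (simp add: t_def)
qed

definition normal_even_moment :: "nat \<Rightarrow> real" where
  "normal_even_moment l = fact (2 * l) / (2 ^ l * fact l)"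

lemma brownian_motion_coordinate_moment:
  fixes B :: "real \<Rightarrow> 'a \<Rightarrow> real^'d"
  assumes BM: "brownian_motion M B" and u: "0 < u"
  shows "(\<integral>\<^sup>+\<omega>. ennreal ((B u \<omega> $ i) ^ (2 * l)) \<partial>M) = ennreal (normal_even_moment l * u ^ l)"
proof -
  have "(\<integral>\<^sup>+\<omega>. ennreal ((B u \<omega> $ i) ^ (2 * l)) \<partial>M)
      = (\<integral>\<^sup>+\<omega>. ennreal ((B u \<omega> $ i - B 0 \<omega> $ i) ^ (2 * l)) \<partial>M)"
    by (intro nn_integral_cong) (simp add: brownian_motion_zero[OF BM])
  also have "\<dots> = (\<integral>\<^sup>+z. ennreal (normal_density 0 (sqrt u) z) * ennreal (z ^ (2 * l)) \<partial>lborel)"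
    using distributed_nn_integral[OF brownian_motion_increment_distributed[OF BM u],
        of "\<lambda>z. ennreal (z ^ (2 * l))"] by simp
  also have "\<dots> = (\<integral>\<^sup>+z. ennreal (normal_density 0 (sqrt u) z * (z - 0) ^ (2 * l)) \<partial>lborel)"
    by (intro nn_integral_cong) (simp add: ennreal_mult)
  also have "\<dots> = ennreal (\<integral>z. normal_density 0 (sqrt u) z * (z - 0) ^ (2 * l) \<partial>lborel)"
    by (intro nn_integral_eq_integral integrable.intros[OF normal_moment_even])
      (use u in \<open>auto simp: power_mult\<close>)
  also have "(\<integral>z. normal_density 0 (sqrt u) z * (z - 0) ^ (2 * l) \<partial>lborel)
      = fact (2 * l) / ((2 / (sqrt u)\<^sup>2) ^ l * fact l)"
    using u by (subst integral_normal_moment_even) auto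
  also have "\<dots> = normal_even_moment l * u ^ l"
    using u by (simp add: normal_even_moment_def power_divide)
  finally show ?thesis .
qed

lemma normal_even_moment_nonneg: "0 \<le> normal_even_moment l"
  by (simp add: normal_even_moment_def)

definition brownian_moment_const :: "nat \<Rightarrow> nat \<Rightarrow> real" where
  "brownian_moment_const d l = real d ^ (2 * l + 1) * normal_even_moment l"

lemma brownian_moment_const_nonneg: "0 \<le> brownian_moment_const d l"
  by (simp add: brownian_moment_const_def normal_even_moment_nonneg)

lemma brownian_motion_norm_moment:
  fixes B :: "real \<Rightarrow> 'a \<Rightarrow> real^'d"
  assumes BM: "brownian_motion M B" and u: "0 \<le> u" and l: "1 \<le> l"
  shows "(\<integral>\<^sup>+\<omega>. ennreal (norm (B u \<omega>) ^ (2 * l)) \<partial>M)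
           \<le> ennreal (brownian_moment_const CARD('d) l * u ^ l)"
proof (cases "u = 0")
  case True
  have "(\<integral>\<^sup>+\<omega>. ennreal (norm (B u \<omega>) ^ (2 * l)) \<partial>M) = (\<integral>\<^sup>+\<omega>. 0 \<partial>M)"
    using l by (intro nn_integral_cong) (simp add: brownian_motion_zero[OF BM] True)
  then show ?thesis by simp
next
  case False
  then have u: "0 < u" using u by auto
  have [measurable]: "B u \<in> borel_measurable M"
    using brownian_motion_measurable[OF BM] u by simp
  have "(\<lambda>v::real^'d. v $ i) \<in> borel_measurable borel" for i
    by (intro borel_measurable_continuous_onI continuous_intros)
  then have [measurable]: "(\<lambda>\<omega>. B u \<omega> $ i) \<in> borel_measurable M" for i
    by (rule measurable_compose[rotated]) measurable
  have coord: "(\<lambda>\<omega>. ennreal ((B u \<omega> $ i) ^ (2 * l))) \<in> borel_measurable M" for i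
    by measurable
  have "(\<integral>\<^sup>+\<omega>. ennreal (norm (B u \<omega>) ^ (2 * l)) \<partial>M)
      \<le> (\<integral>\<^sup>+\<omega>. ennreal (real CARD('d) ^ (2 * l)) * (\<Sum>i\<in>UNIV. ennreal ((B u \<omega> $ i) ^ (2 * l))) \<partial>M)"
  proof (rule nn_integral_mono)
    fix \<omega>
    have "norm (B u \<omega>) ^ (2 * l) \<le> real CARD('d) ^ (2 * l) * (\<Sum>i\<in>UNIV. (B u \<omega> $ i) ^ (2 * l))"
      using norm_power_le_sum_abs_power[of "B u \<omega>" "2 * l"] by (simp add: power_even_abs)
    then have "ennreal (norm (B u \<omega>) ^ (2 * l))
        \<le> ennreal (real CARD('d) ^ (2 * l) * (\<Sum>i\<in>UNIV. (B u \<omega> $ i) ^ (2 * l)))"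
      by (rule ennreal_leI)
    then show "ennreal (norm (B u \<omega>) ^ (2 * l))
        \<le> ennreal (real CARD('d) ^ (2 * l)) * (\<Sum>i\<in>UNIV. ennreal ((B u \<omega> $ i) ^ (2 * l)))"
      by (simp add: ennreal_mult sum_nonneg zero_le_even_power)
  qed
  also have "\<dots> = ennreal (real CARD('d) ^ (2 * l)) * (\<Sum>i\<in>UNIV. \<integral>\<^sup>+\<omega>. ennreal ((B u \<omega> $ i) ^ (2 * l)) \<partial>M)"
  proof -
    have "(\<lambda>\<omega>. \<Sum>i\<in>UNIV. ennreal ((B u \<omega> $ i) ^ (2 * l))) \<in> borel_measurable M"
      using coord by (intro borel_measurable_sum) auto
    then show ?thesis
      by (simp only: nn_integral_cmult nn_integral_sum[OF coord])
  qed
  also have "\<dots> = ennreal (real CARD('d) ^ (2 * l)) * (\<Sum>i\<in>(UNIV::'d set). ennreal (normal_even_moment l * u ^ l))"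
    by (simp only: brownian_motion_coordinate_moment[OF BM u])
  also have "\<dots> = ennreal (real CARD('d) ^ (2 * l) * real CARD('d) * normal_even_moment l * u ^ l)"
    using u normal_even_moment_nonneg
    by (simp add: ennreal_of_nat_eq_real_of_nat ennreal_mult' mult.assoc)
  also have "\<dots> = ennreal (brownian_moment_const CARD('d) l * u ^ l)"
    by (simp add: brownian_moment_const_def algebra_simps)
  finally show ?thesis .
qed

lemma floor_mult_div_LIMSEQ:
  fixes y :: real
  shows "(\<lambda>n. real_of_int \<lfloor>real (Suc n) * y\<rfloor> / real (Suc n)) \<longlonglongrightarrow> y"
proof -
  have lower: "y + - inverse N \<le> real_of_int \<lfloor>N * y\<rfloor> / N"
    and upper: "real_of_int \<lfloor>N * y\<rfloor> / N \<le> y" if N: "0 < N" for N :: real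
  proof -
    have "y + - inverse N = (N * y - 1) / N"
      using N by (simp add: field_simps)
    also have "\<dots> \<le> real_of_int \<lfloor>N * y\<rfloor> / N"
      using N by (intro divide_right_mono) linarith+
    finally show "y + - inverse N \<le> real_of_int \<lfloor>N * y\<rfloor> / N" .
    have "real_of_int \<lfloor>N * y\<rfloor> / N \<le> N * y / N"
      using N by (intro divide_right_mono) linarith+
    then show "real_of_int \<lfloor>N * y\<rfloor> / N \<le> y"
      using N by simp
  qed
  show ?thesis
    by (rule tendsto_sandwich[OF always_eventually always_eventually
          LIMSEQ_inverse_real_of_nat_add_minus tendsto_const])
      (use lower upper in auto)
qed

text \<open>B is the pointwise limit (by path continuity) of its samples on the grids {k / (n + 1)},
  each of which is a countable gluing of measurable maps. Times are clamped at 0 because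
  B is only specified, and measurable, for nonnegative times.\<close>
lemma brownian_motion_jointly_measurable:
  assumes BM: "brownian_motion M B"
  shows "(\<lambda>z. B (max 0 (snd z)) (fst z)) \<in> borel_measurable (M \<Otimes>\<^sub>M lborel)"
proof (rule borel_measurable_LIMSEQ_metric)
  fix n :: nat
  have grid: "(\<lambda>z. B (max 0 (real_of_int i / real (Suc n))) (fst z)) \<in> borel_measurable (M \<Otimes>\<^sub>M lborel)" for i
    by (rule measurable_compose[OF measurable_fst brownian_motion_measurable[OF BM]]) auto
  have index: "(\<lambda>z. \<lfloor>real (Suc n) * snd z\<rfloor>) \<in> measurable (M \<Otimes>\<^sub>M lborel) (count_space UNIV)"
    by (rule measurable_compose[OF _ measurable_real_floor]) measurable
  show "(\<lambda>z. B (max 0 (real_of_int \<lfloor>real (Suc n) * snd z\<rfloor> / real (Suc n))) (fst z))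
      \<in> borel_measurable (M \<Otimes>\<^sub>M lborel)"
    by (rule measurable_compose_countable'[where f="\<lambda>i z. B (max 0 (real_of_int i / real (Suc n))) (fst z)"
          and g="\<lambda>z. \<lfloor>real (Suc n) * snd z\<rfloor>" and I=UNIV]) (use grid index in auto)
next
  fix z :: "'a \<times> real" assume "z \<in> space (M \<Otimes>\<^sub>M lborel)"
  then have "continuous_on {0..} (\<lambda>t. B t (fst z))"
    by (intro brownian_motion_continuous[OF BM]) (auto simp: space_pair_measure)
  moreover have "(\<lambda>n. max 0 (real_of_int \<lfloor>real (Suc n) * snd z\<rfloor> / real (Suc n))) \<longlonglongrightarrow> max 0 (snd z)"
    by (intro tendsto_max tendsto_const floor_mult_div_LIMSEQ)
  ultimately show "(\<lambda>n. B (max 0 (real_of_int \<lfloor>real (Suc n) * snd z\<rfloor> / real (Suc n))) (fst z))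
      \<longlonglongrightarrow> B (max 0 (snd z)) (fst z)"
    by (auto intro: continuous_on_tendsto_compose)
qed

lemma brownian_motion_time_integral_measurable:
  fixes B :: "real \<Rightarrow> 'a \<Rightarrow> real^'d" and f :: "real^'d \<Rightarrow> real"
  assumes BM: "brownian_motion M B" and f: "f \<in> borel_measurable borel"
  shows "(\<lambda>\<omega>. \<integral>\<^sup>+u. ennreal (indicator {0..t} u * f (B u \<omega>)) \<partial>lborel) \<in> borel_measurable M"
proof -
  have [measurable]: "f \<in> borel_measurable borel"
    "(\<lambda>z. B (max 0 (snd z)) (fst z)) \<in> borel_measurable (M \<Otimes>\<^sub>M lborel)"
    using f brownian_motion_jointly_measurable[OF BM] by auto
  have "(\<lambda>(\<omega>, u). ennreal (indicator {0..t} u * f (B (max 0 u) \<omega>))) \<in> borel_measurable (M \<Otimes>\<^sub>M lborel)"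
    by measurable
  from lborel.borel_measurable_nn_integral[OF this] show ?thesis
    by (rule measurable_cong[THEN iffD1, rotated])
      (auto intro!: nn_integral_cong simp: indicator_def)
qed

lemma brownian_motion_time_integral_moment:
  fixes B :: "real \<Rightarrow> 'a \<Rightarrow> real^'d"
  assumes BM: "brownian_motion M B" and t: "0 \<le> t" and l: "1 \<le> l"
  shows "(\<integral>\<^sup>+\<omega>. (\<integral>\<^sup>+u. ennreal (indicator {0..t} u * norm (B u \<omega>) ^ (2 * l)) \<partial>lborel) \<partial>M)
           \<le> ennreal (brownian_moment_const CARD('d) l * t ^ l * t)"
proof -
  define c where "c = brownian_moment_const CARD('d) l"
  have c: "0 \<le> c" unfolding c_def by (rule brownian_moment_const_nonneg)
  define F where "F \<omega> u = ennreal (indicator {0..t} u * norm (B (max 0 u) \<omega>) ^ (2 * l))" for \<omega> u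
  have F_eq: "ennreal (indicator {0..t} u * norm (B u \<omega>) ^ (2 * l)) = F \<omega> u" for \<omega> u
    unfolding F_def by (cases "u \<in> {0..t}") auto
  have [measurable]: "(\<lambda>z. B (max 0 (snd z)) (fst z)) \<in> borel_measurable (M \<Otimes>\<^sub>M lborel)"
    by (rule brownian_motion_jointly_measurable[OF BM])
  have F_meas: "case_prod F \<in> borel_measurable (M \<Otimes>\<^sub>M lborel)"
    unfolding F_def split_beta' by measurable
  interpret pair_sigma_finite M lborel
    by (intro pair_sigma_finite.intro prob_space_imp_sigma_finite[OF brownian_motion_prob_space[OF BM]])
      (rule lborel.sigma_finite_measure_axioms)
  have pointwise: "(\<integral>\<^sup>+\<omega>. F \<omega> u \<partial>M) \<le> ennreal (c * t ^ l) * indicator {0..t} u" for u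
  proof (cases "u \<in> {0..t}")
    case True
    have "(\<integral>\<^sup>+\<omega>. F \<omega> u \<partial>M) = (\<integral>\<^sup>+\<omega>. ennreal (norm (B u \<omega>) ^ (2 * l)) \<partial>M)"
      unfolding F_def using True by (intro nn_integral_cong) auto
    also have "\<dots> \<le> ennreal (c * u ^ l)"
      unfolding c_def using True by (intro brownian_motion_norm_moment[OF BM _ l]) auto
    also have "\<dots> \<le> ennreal (c * t ^ l)"
      using True c by (intro ennreal_leI mult_left_mono power_mono) auto
    finally show ?thesis using True by simp
  qed (simp add: F_def)
  have "(\<integral>\<^sup>+\<omega>. (\<integral>\<^sup>+u. ennreal (indicator {0..t} u * norm (B u \<omega>) ^ (2 * l)) \<partial>lborel) \<partial>M)
      = (\<integral>\<^sup>+u. (\<integral>\<^sup>+\<omega>. F \<omega> u \<partial>M) \<partial>lborel)"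
    unfolding F_eq by (rule Fubini'[OF F_meas, symmetric])
  also have "\<dots> \<le> (\<integral>\<^sup>+u. ennreal (c * t ^ l) * indicator {0..t} u \<partial>lborel)"
    by (intro nn_integral_mono pointwise)
  also have "\<dots> = ennreal (c * t ^ l * t)"
    using t c by (simp add: nn_integral_cmult_indicator ennreal_mult)
  finally show ?thesis unfolding c_def .
qed

lemma brownian_motion_time_integral_eq:
  fixes B :: "real \<Rightarrow> 'a \<Rightarrow> real^'d" and h :: "real^'d \<Rightarrow> real"
  assumes BM: "brownian_motion M B" and \<omega>: "\<omega> \<in> space M"
    and ch: "continuous_on UNIV h" and h_nonneg: "\<And>v. 0 \<le> h v"
  shows "(\<integral>\<^sup>+u. ennreal (indicator {0..t} u * h (B u \<omega>)) \<partial>lborel) = ennreal (integral {0..t} (\<lambda>u. h (B u \<omega>)))"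
proof -
  have "((\<lambda>u. h (B u \<omega>)) has_integral integral {0..t} (\<lambda>u. h (B u \<omega>))) {0..t}"
    using brownian_motion_continuous_interval[OF BM \<omega>]
    by (intro integrable_integral integrable_continuous_real continuous_on_compose2[OF ch]) auto
  from nn_integral_has_integral_lebesgue[OF h_nonneg this] show ?thesis
    by simp
qed

lemma brownian_motion_integral_norm_power_measurable:
  fixes B :: "real \<Rightarrow> 'a \<Rightarrow> real^'d"
  assumes BM: "brownian_motion M B"
  shows "(\<lambda>\<omega>. ennreal (integral {0..t} (\<lambda>u. norm (B u \<omega>)) ^ n)) \<in> borel_measurable M"
proof -
  have "(\<lambda>\<omega>. (\<integral>\<^sup>+u. ennreal (indicator {0..t} u * norm (B u \<omega>)) \<partial>lborel) ^ n) \<in> borel_measurable M"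
    using brownian_motion_time_integral_measurable[OF BM borel_measurable_norm] by measurable
  moreover have "(\<integral>\<^sup>+u. ennreal (indicator {0..t} u * norm (B u \<omega>)) \<partial>lborel) ^ n
      = ennreal (integral {0..t} (\<lambda>u. norm (B u \<omega>)) ^ n)" if \<omega>: "\<omega> \<in> space M" for \<omega>
  proof -
    from brownian_motion_integral_norm_nonneg[OF BM \<omega>] show ?thesis
      using brownian_motion_time_integral_eq[OF BM \<omega> continuous_on_norm_id norm_ge_zero, of t]
      by (simp add: ennreal_power)
  qed
  ultimately show ?thesis
    by (simp cong: measurable_cong)
qed

text \<open>Jensen's inequality in time, followed by Fubini: the time average of |B| over [0, t]
  has at most the moments of |B_t|, which are of order t^l.\<close>
lemma brownian_motion_integral_norm_moment:
  fixes B :: "real \<Rightarrow> 'a \<Rightarrow> real^'d"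
  assumes BM: "brownian_motion M B" and t: "0 \<le> t" and l: "1 \<le> l"
  shows "(\<integral>\<^sup>+\<omega>. ennreal (integral {0..t} (\<lambda>u. norm (B u \<omega>)) ^ (2 * l)) \<partial>M)
           \<le> ennreal (brownian_moment_const CARD('d) l * t ^ (3 * l))"
proof -
  define J where "J \<omega> = (\<integral>\<^sup>+u. ennreal (indicator {0..t} u * norm (B u \<omega>) ^ (2 * l)) \<partial>lborel)" for \<omega>
  have "(\<integral>\<^sup>+\<omega>. ennreal (integral {0..t} (\<lambda>u. norm (B u \<omega>)) ^ (2 * l)) \<partial>M)
      \<le> (\<integral>\<^sup>+\<omega>. ennreal (t ^ (2 * l - 1)) * J \<omega> \<partial>M)"
  proof (rule nn_integral_mono)
    fix \<omega> assume \<omega>: "\<omega> \<in> space M"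
    have "integral {0..t} (\<lambda>u. norm (B u \<omega>)) ^ (2 * l)
        \<le> t ^ (2 * l - 1) * integral {0..t} (\<lambda>u. norm (B u \<omega>) ^ (2 * l))"
      using l brownian_motion_continuous_interval[OF BM \<omega>] by (intro power_integral_le continuous_intros) auto
    then have "ennreal (integral {0..t} (\<lambda>u. norm (B u \<omega>)) ^ (2 * l))
        \<le> ennreal (t ^ (2 * l - 1) * integral {0..t} (\<lambda>u. norm (B u \<omega>) ^ (2 * l)))"
      by (rule ennreal_leI)
    also have "\<dots> = ennreal (t ^ (2 * l - 1)) * J \<omega>"
      unfolding J_def using t brownian_motion_time_integral_eq[OF BM \<omega>, of "\<lambda>v. norm v ^ (2 * l)" t]
      by (simp add: continuous_on_power continuous_on_norm_id ennreal_mult')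
    finally show "ennreal (integral {0..t} (\<lambda>u. norm (B u \<omega>)) ^ (2 * l)) \<le> ennreal (t ^ (2 * l - 1)) * J \<omega>" .
  qed
  also have "\<dots> = ennreal (t ^ (2 * l - 1)) * (\<integral>\<^sup>+\<omega>. J \<omega> \<partial>M)"
    unfolding J_def by (intro nn_integral_cmult brownian_motion_time_integral_measurable[OF BM]) measurable
  also have "\<dots> \<le> ennreal (t ^ (2 * l - 1)) * ennreal (brownian_moment_const CARD('d) l * t ^ l * t)"
    unfolding J_def by (intro mult_left_mono brownian_motion_time_integral_moment[OF BM t l]) auto
  also have "\<dots> = ennreal (brownian_moment_const CARD('d) l * t ^ (3 * l))"
  proof -
    have "2 * l - 1 + l + 1 = 3 * l"
      using l by simp
    then have "t ^ (2 * l - 1) * (t ^ l * t) = t ^ (3 * l)"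
      by (metis power_add power_one_right mult.assoc)
    then have prod: "t ^ (2 * l - 1) * (brownian_moment_const CARD('d) l * t ^ l * t)
        = brownian_moment_const CARD('d) l * t ^ (3 * l)"
      by (metis mult.assoc mult.left_commute)
    have "ennreal (t ^ (2 * l - 1)) * ennreal (brownian_moment_const CARD('d) l * t ^ l * t)
        = ennreal (t ^ (2 * l - 1) * (brownian_moment_const CARD('d) l * t ^ l * t))"
      using t by (simp add: ennreal_mult')
    then show ?thesis
      by (simp only: prod)
  qed
  finally show ?thesis .
qed

section \<open>The drift and the Lyapunov function\<close>

lemma drift_lipschitz:
  fixes R :: "real^'d^'d"
  shows "(onorm ((*v) R) + norm (onevec :: real^'d) * norm ((R - \<alpha> *\<^sub>R mat 1) *v p))-lipschitz_on UNIV
           (drift \<alpha> \<beta> p R)"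
proof (rule lipschitz_onI)
  define w where "w = (R - \<alpha> *\<^sub>R mat 1) *v p"
  fix y z :: "real^'d"
  have "drift \<alpha> \<beta> p R y - drift \<alpha> \<beta> p R z
      = - (R *v (y - z)) + (max 0 (onevec \<bullet> y) - max 0 (onevec \<bullet> z)) *\<^sub>R w"
    unfolding drift_def w_def by (simp add: matrix_vector_mult_diff_distrib algebra_simps scaleR_diff_left)
  then have "dist (drift \<alpha> \<beta> p R y) (drift \<alpha> \<beta> p R z)
      \<le> norm (R *v (y - z)) + \<bar>max 0 (onevec \<bullet> y) - max 0 (onevec \<bullet> z)\<bar> * norm w"
    unfolding dist_norm by (metis norm_minus_cancel norm_scaleR norm_triangle_ineq)
  also have "\<dots> \<le> onorm ((*v) R) * norm (y - z) + norm (onevec :: real^'d) * norm (y - z) * norm w"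
  proof (intro add_mono mult_right_mono)
    show "norm (R *v (y - z)) \<le> onorm ((*v) R) * norm (y - z)"
      by (rule onorm[OF matrix_vector_mul_bounded_linear])
    have "\<bar>max 0 (onevec \<bullet> y) - max 0 (onevec \<bullet> z)\<bar> \<le> \<bar>onevec \<bullet> (y - z)\<bar>"
      by (simp add: inner_diff_right; linarith)
    also have "\<dots> \<le> norm (onevec :: real^'d) * norm (y - z)"
      by (rule Cauchy_Schwarz_ineq2)
    finally show "\<bar>max 0 (onevec \<bullet> y) - max 0 (onevec \<bullet> z)\<bar> \<le> norm (onevec :: real^'d) * norm (y - z)" .
  qed simp
  finally show "dist (drift \<alpha> \<beta> p R y) (drift \<alpha> \<beta> p R z)
      \<le> (onorm ((*v) R) + norm (onevec :: real^'d) * norm ((R - \<alpha> *\<^sub>R mat 1) *v p)) * dist y z"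
    by (simp add: dist_norm w_def algebra_simps)
qed (simp add: onorm_pos_le)

lemma lipschitz_power_growth_le:
  fixes g :: "'v::real_normed_vector \<Rightarrow> 'w::real_normed_vector"
  assumes lip: "L-lipschitz_on UNIV g" and a: "0 < a" and v: "a * (norm x)\<^sup>2 \<le> v"
  shows "1 + norm (g x) ^ (2 * l)
           \<le> (1 + 2 ^ (2 * l) * (norm (g 0) ^ (2 * l) + L ^ (2 * l) / a ^ l)) * (1 + v ^ l)"
proof -
  define G where "G = norm (g 0) ^ (2 * l)"
  define \<Lambda> where "\<Lambda> = L ^ (2 * l) / a ^ l"
  have L: "0 \<le> L"
    using lip by (rule lipschitz_on_nonneg)
  have "0 \<le> a * (norm x)\<^sup>2"
    using a by simp
  then have v_nonneg: "0 \<le> v"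
    using v by linarith
  have "norm (g x) \<le> norm (g 0) + norm (g x - g 0)"
    by (metis norm_triangle_sub add.commute)
  also have "\<dots> \<le> norm (g 0) + L * norm x"
    using lipschitz_onD[OF lip, of x 0] by (simp add: dist_norm)
  finally have "norm (g x) ^ (2 * l) \<le> (norm (g 0) + L * norm x) ^ (2 * l)"
    by (intro power_mono) auto
  also have "\<dots> \<le> 2 ^ (2 * l) * (G + (L * norm x) ^ (2 * l))"
    unfolding G_def using L by (intro power_add_le) auto
  also have "(L * norm x) ^ (2 * l) \<le> \<Lambda> * v ^ l"
  proof -
    have "(L * norm x) ^ (2 * l) = L ^ (2 * l) * ((norm x)\<^sup>2) ^ l"
      by (simp add: power_mult_distrib power_mult)
    also have "\<dots> \<le> L ^ (2 * l) * (v / a) ^ l"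
      using v a L by (intro mult_left_mono power_mono) (auto simp: field_simps)
    finally show ?thesis
      by (simp add: \<Lambda>_def power_divide)
  qed
  finally have "norm (g x) ^ (2 * l) \<le> 2 ^ (2 * l) * (G + \<Lambda> * v ^ l)"
    by simp
  moreover have "(1 + 2 ^ (2 * l) * (G + \<Lambda>)) * (1 + v ^ l)
      = 1 + 2 ^ (2 * l) * (G + \<Lambda> * v ^ l) + (v ^ l + 2 ^ (2 * l) * (G * v ^ l + \<Lambda>))"
    by (simp add: algebra_simps)
  moreover have "0 \<le> v ^ l + 2 ^ (2 * l) * (G * v ^ l + \<Lambda>)"
    using v_nonneg a L unfolding G_def \<Lambda>_def by simp
  ultimately show ?thesis
    unfolding G_def \<Lambda>_def by linarith
qed

section \<open>Lipschitz SDEs with additive noise\<close>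

locale lipschitz_additive_sde =
  fixes M :: "'a measure" and B :: "real \<Rightarrow> 'a \<Rightarrow> real^'d"
    and g :: "real^'d \<Rightarrow> real^'d" and \<sigma> :: "real^'d^'d"
    and X :: "real^'d \<Rightarrow> real \<Rightarrow> 'a \<Rightarrow> real^'d" and L K :: real
  assumes BM: "brownian_motion M B"
    and sol: "\<And>x. solves_sde M g \<sigma> B x (X x)"
    and lip: "L-lipschitz_on UNIV g"
    and K_nonneg: "0 \<le> K" and noise_bound: "\<And>z. norm (\<sigma> *v z) \<le> K * norm z"
begin

lemma L_nonneg: "0 \<le> L"
  using lip by (rule lipschitz_on_nonneg)

lemma sample_path:
  assumes "\<omega> \<in> space M"
  shows "continuous_on {0..t} (\<lambda>r. X x r \<omega>)"
    and "\<And>r. r \<in> {0..t} \<Longrightarrow> X x r \<omega> = x + integral {0..r} (\<lambda>u. g (X x u \<omega>)) + \<sigma> *v B r \<omega>"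
  using sol[of x] assms unfolding solves_sde_def by (auto intro: continuous_on_subset)

lemma noise_path_continuous:
  assumes "\<omega> \<in> space M"
  shows "continuous_on {0..t} (\<lambda>r. \<sigma> *v B r \<omega>)"
  by (rule bounded_linear.continuous_on[OF matrix_vector_mul_bounded_linear
        brownian_motion_continuous_interval[OF BM assms]])

lemma noise_integral_le:
  assumes \<omega>: "\<omega> \<in> space M" and t: "0 \<le> t"
  shows "integral {0..t} (\<lambda>u. norm (\<sigma> *v B u \<omega>)) \<le> K * integral {0..t} (\<lambda>u. norm (B u \<omega>))"
proof -
  have "integral {0..t} (\<lambda>u. norm (\<sigma> *v B u \<omega>)) \<le> integral {0..t} (\<lambda>u. K * norm (B u \<omega>))"
    using noise_bound brownian_motion_continuous_interval[OF BM \<omega>] noise_path_continuous[OF \<omega>]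
    by (intro integral_le integrable_continuous_real continuous_intros) auto
  then show ?thesis by simp
qed

lemma noise_integral_nonneg:
  assumes "\<omega> \<in> space M"
  shows "0 \<le> integral {0..t} (\<lambda>u. norm (\<sigma> *v B u \<omega>))"
  using noise_path_continuous[OF assms]
  by (intro integral_nonneg integrable_continuous_real continuous_intros) auto

lemma gronwall_factor_le:
  assumes "0 \<le> t" "t \<le> 1"
  shows "L * exp (L * t) \<le> L * exp L"
  using L_nonneg assms by (intro mult_left_mono) (auto simp: mult_left_le)

lemma increment_pathwise_bound:
  assumes \<omega>: "\<omega> \<in> space M" and t: "0 \<le> t" "t \<le> 1"
  shows "norm (X x t \<omega> - x) \<le> (L * exp L + 1) * t * norm (g x)
           + L * exp L * K * integral {0..t} (\<lambda>u. norm (B u \<omega>)) + K * norm (B t \<omega>)"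
proof -
  note path = sample_path[OF \<omega>]
  note cN = noise_path_continuous[OF \<omega>]
  have "norm (X x t \<omega> - x) \<le> L * exp (L * t) * (t\<^sup>2 * norm (g x) + integral {0..t} (\<lambda>u. norm (\<sigma> *v B u \<omega>)))
      + t * norm (g x) + norm (\<sigma> *v B t \<omega>)"
    by (rule integral_equation_increment_bound[OF lip path(1) cN t(1) path(2)])
  also have "\<dots> \<le> L * exp L * (t * norm (g x) + K * integral {0..t} (\<lambda>u. norm (B u \<omega>)))
      + t * norm (g x) + K * norm (B t \<omega>)"
  proof -
    have "L * exp (L * t) * (t\<^sup>2 * norm (g x) + integral {0..t} (\<lambda>u. norm (\<sigma> *v B u \<omega>)))
        \<le> L * exp L * (t * norm (g x) + K * integral {0..t} (\<lambda>u. norm (B u \<omega>)))"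
    proof (rule mult_mono)
      show "t\<^sup>2 * norm (g x) + integral {0..t} (\<lambda>u. norm (\<sigma> *v B u \<omega>))
          \<le> t * norm (g x) + K * integral {0..t} (\<lambda>u. norm (B u \<omega>))"
        using t noise_integral_le[OF \<omega> t(1)]
        by (intro add_mono mult_right_mono) (auto simp: power2_eq_square mult_left_le_one_le)
    qed (use gronwall_factor_le[OF t] L_nonneg noise_integral_nonneg[OF \<omega>] t in auto)
    then show ?thesis
      using noise_bound[of "B t \<omega>"] by linarith
  qed
  finally show ?thesis
    by (simp add: algebra_simps)
qed

lemma euler_error_pathwise_bound:
  assumes \<omega>: "\<omega> \<in> space M" and t: "0 \<le> t" "t \<le> 1"
  shows "norm (X x t \<omega> - (x + t *\<^sub>R g x + \<sigma> *v B t \<omega>))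
           \<le> (L * exp L + 1) * t\<^sup>2 * norm (g x) + L * exp L * K * integral {0..t} (\<lambda>u. norm (B u \<omega>))"
proof -
  note path = sample_path[OF \<omega>]
  note cN = noise_path_continuous[OF \<omega>]
  have "norm (X x t \<omega> - (x + t *\<^sub>R g x + \<sigma> *v B t \<omega>))
      \<le> L * exp (L * t) * (t\<^sup>2 * norm (g x) + integral {0..t} (\<lambda>u. norm (\<sigma> *v B u \<omega>)))"
    by (rule integral_equation_euler_error_bound[OF lip path(1) cN t(1) path(2)])
  also have "\<dots> \<le> L * exp L * (t\<^sup>2 * norm (g x) + K * integral {0..t} (\<lambda>u. norm (B u \<omega>)))"
  proof (rule mult_mono)
    show "t\<^sup>2 * norm (g x) + integral {0..t} (\<lambda>u. norm (\<sigma> *v B u \<omega>))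
        \<le> t\<^sup>2 * norm (g x) + K * integral {0..t} (\<lambda>u. norm (B u \<omega>))"
      using noise_integral_le[OF \<omega> t(1)] by simp
  qed (use gronwall_factor_le[OF t] L_nonneg noise_integral_nonneg[OF \<omega>] t in auto)
  also have "\<dots> \<le> (L * exp L + 1) * t\<^sup>2 * norm (g x) + L * exp L * K * integral {0..t} (\<lambda>u. norm (B u \<omega>))"
    by (simp add: algebra_simps)
  finally show ?thesis .
qed

lemma increment_moment:
  assumes l: "1 \<le> l" and t: "0 \<le> t" "t \<le> 1"
  defines "c \<equiv> brownian_moment_const CARD('d) l"
  shows "(\<integral>\<^sup>+\<omega>. ennreal (norm (X x t \<omega> - x) ^ (2 * l)) \<partial>M)
           \<le> ennreal (3 ^ (2 * l) * (((L * exp L + 1) * t * norm (g x)) ^ (2 * l)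
                + (L * exp L * K) ^ (2 * l) * (c * t ^ (3 * l)) + K ^ (2 * l) * (c * t ^ l)))"
proof (rule prob_space.nn_integral_power_le_sum3[OF brownian_motion_prob_space[OF BM],
      where Y="\<lambda>\<omega>. integral {0..t} (\<lambda>u. norm (B u \<omega>))" and Z="\<lambda>\<omega>. norm (B t \<omega>)"])
  have [measurable]: "B t \<in> borel_measurable M"
    using brownian_motion_measurable[OF BM t(1)] .
  show "(\<lambda>\<omega>. ennreal (norm (B t \<omega>) ^ (2 * l))) \<in> borel_measurable M"
    by measurable
  show "(\<lambda>\<omega>. ennreal (integral {0..t} (\<lambda>u. norm (B u \<omega>)) ^ (2 * l))) \<in> borel_measurable M"
    by (rule brownian_motion_integral_norm_power_measurable[OF BM])
  show "(\<integral>\<^sup>+\<omega>. ennreal (integral {0..t} (\<lambda>u. norm (B u \<omega>)) ^ (2 * l)) \<partial>M) \<le> ennreal (c * t ^ (3 * l))"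
    unfolding c_def by (rule brownian_motion_integral_norm_moment[OF BM t(1) l])
  show "(\<integral>\<^sup>+\<omega>. ennreal (norm (B t \<omega>) ^ (2 * l)) \<partial>M) \<le> ennreal (c * t ^ l)"
    unfolding c_def by (rule brownian_motion_norm_moment[OF BM t(1) l])
  show "0 \<le> c * t ^ (3 * l)" "0 \<le> c * t ^ l"
    unfolding c_def using t brownian_moment_const_nonneg by auto
  show "0 \<le> (L * exp L + 1) * t * norm (g x)" "0 \<le> L * exp L * K" "0 \<le> K"
    using L_nonneg K_nonneg t by auto
  show "0 \<le> norm (X x t \<omega> - x) \<and>
      norm (X x t \<omega> - x) \<le> (L * exp L + 1) * t * norm (g x)
        + L * exp L * K * integral {0..t} (\<lambda>u. norm (B u \<omega>)) + K * norm (B t \<omega>) \<and>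
      0 \<le> integral {0..t} (\<lambda>u. norm (B u \<omega>)) \<and> 0 \<le> norm (B t \<omega>)" if "\<omega> \<in> space M" for \<omega>
    using increment_pathwise_bound[OF that t] brownian_motion_integral_norm_nonneg[OF BM that] by auto
qed

lemma euler_error_moment:
  assumes l: "1 \<le> l" and t: "0 \<le> t" "t \<le> 1"
  defines "c \<equiv> brownian_moment_const CARD('d) l"
  shows "(\<integral>\<^sup>+\<omega>. ennreal (norm (X x t \<omega> - (x + t *\<^sub>R g x + \<sigma> *v B t \<omega>)) ^ (2 * l)) \<partial>M)
           \<le> ennreal (3 ^ (2 * l) * (((L * exp L + 1) * t\<^sup>2 * norm (g x)) ^ (2 * l)
                + (L * exp L * K) ^ (2 * l) * (c * t ^ (3 * l))))"
proof -
  have "(\<integral>\<^sup>+\<omega>. ennreal (norm (X x t \<omega> - (x + t *\<^sub>R g x + \<sigma> *v B t \<omega>)) ^ (2 * l)) \<partial>M)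
      \<le> ennreal (3 ^ (2 * l) * (((L * exp L + 1) * t\<^sup>2 * norm (g x)) ^ (2 * l)
           + (L * exp L * K) ^ (2 * l) * (c * t ^ (3 * l)) + 0 ^ (2 * l) * 0))"
  proof (rule prob_space.nn_integral_power_le_sum3[OF brownian_motion_prob_space[OF BM],
        where Y="\<lambda>\<omega>. integral {0..t} (\<lambda>u. norm (B u \<omega>))" and Z="\<lambda>_. 0"])
    show "(\<lambda>\<omega>. ennreal (integral {0..t} (\<lambda>u. norm (B u \<omega>)) ^ (2 * l))) \<in> borel_measurable M"
      by (rule brownian_motion_integral_norm_power_measurable[OF BM])
    show "(\<integral>\<^sup>+\<omega>. ennreal (integral {0..t} (\<lambda>u. norm (B u \<omega>)) ^ (2 * l)) \<partial>M) \<le> ennreal (c * t ^ (3 * l))"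
      unfolding c_def by (rule brownian_motion_integral_norm_moment[OF BM t(1) l])
    show "(\<integral>\<^sup>+\<omega>. ennreal (0 ^ (2 * l)) \<partial>M) \<le> ennreal 0"
      using l by simp
    show "0 \<le> c * t ^ (3 * l)"
      unfolding c_def using t brownian_moment_const_nonneg by auto
    show "0 \<le> (L * exp L + 1) * t\<^sup>2 * norm (g x)" "0 \<le> L * exp L * K"
      using L_nonneg K_nonneg by auto
    show "0 \<le> norm (X x t \<omega> - (x + t *\<^sub>R g x + \<sigma> *v B t \<omega>)) \<and>
        norm (X x t \<omega> - (x + t *\<^sub>R g x + \<sigma> *v B t \<omega>)) \<le> (L * exp L + 1) * t\<^sup>2 * norm (g x)
          + L * exp L * K * integral {0..t} (\<lambda>u. norm (B u \<omega>)) + 0 * 0 \<and>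
        0 \<le> integral {0..t} (\<lambda>u. norm (B u \<omega>)) \<and> 0 \<le> (0::real)" if "\<omega> \<in> space M" for \<omega>
      using euler_error_pathwise_bound[OF that t] brownian_motion_integral_norm_nonneg[OF BM that] by auto
  qed auto
  then show ?thesis
    using l by simp
qed

definition moment_const :: "nat \<Rightarrow> real" where
  "moment_const l = 3 ^ (2 * l) * ((L * exp L + 1) ^ (2 * l)
     + (L * exp L * K) ^ (2 * l) * brownian_moment_const CARD('d) l + K ^ (2 * l) * brownian_moment_const CARD('d) l)"

lemma moment_const_pos: "0 < moment_const l"
proof -
  have "0 < (L * exp L + 1) ^ (2 * l)"
    using L_nonneg by (intro zero_less_power add_nonneg_pos) auto
  then show ?thesis
    unfolding moment_const_def using K_nonneg brownian_moment_const_nonneg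
    by (intro mult_pos_pos add_pos_nonneg) auto
qed

lemma increment_moment_le:
  assumes l: "1 \<le> l" and t: "0 \<le> t" "t \<le> 1"
  shows "(\<integral>\<^sup>+\<omega>. ennreal (norm (X x t \<omega> - x) ^ (2 * l)) \<partial>M)
           \<le> ennreal (moment_const l * (1 + norm (g x) ^ (2 * l)) * t ^ l)"
proof -
  define c where "c = brownian_moment_const CARD('d) l"
  have "(\<integral>\<^sup>+\<omega>. ennreal (norm (X x t \<omega> - x) ^ (2 * l)) \<partial>M)
      \<le> ennreal (3 ^ (2 * l) * (((L * exp L + 1) * t * norm (g x)) ^ (2 * l)
           + (L * exp L * K) ^ (2 * l) * (c * t ^ (3 * l)) + K ^ (2 * l) * (c * t ^ l)))"
    unfolding c_def by (rule increment_moment[OF l t])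
  also have "\<dots> = ennreal (3 ^ (2 * l) * ((L * exp L + 1) ^ (2 * l) * norm (g x) ^ (2 * l) * t ^ (2 * l)
           + (L * exp L * K) ^ (2 * l) * c * t ^ (3 * l) + K ^ (2 * l) * c * t ^ l))"
    by (simp add: power_mult_distrib ac_simps)
  also have "\<dots> \<le> ennreal (moment_const l * (1 + norm (g x) ^ (2 * l)) * t ^ l)"
    unfolding moment_const_def c_def using t L_nonneg K_nonneg brownian_moment_const_nonneg
    by (intro ennreal_leI moment_bound_collect) auto
  finally show ?thesis .
qed

lemma euler_error_moment_le:
  assumes l: "1 \<le> l" and t: "0 \<le> t" "t \<le> 1"
  shows "(\<integral>\<^sup>+\<omega>. ennreal (norm (X x t \<omega> - (x + t *\<^sub>R g x + \<sigma> *v B t \<omega>)) ^ (2 * l)) \<partial>M)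
           \<le> ennreal (moment_const l * (1 + norm (g x) ^ (2 * l)) * t ^ (3 * l))"
proof -
  define c where "c = brownian_moment_const CARD('d) l"
  have c: "0 \<le> c"
    unfolding c_def by (rule brownian_moment_const_nonneg)
  have "(\<integral>\<^sup>+\<omega>. ennreal (norm (X x t \<omega> - (x + t *\<^sub>R g x + \<sigma> *v B t \<omega>)) ^ (2 * l)) \<partial>M)
      \<le> ennreal (3 ^ (2 * l) * (((L * exp L + 1) * t\<^sup>2 * norm (g x)) ^ (2 * l)
           + (L * exp L * K) ^ (2 * l) * (c * t ^ (3 * l))))"
    unfolding c_def by (rule euler_error_moment[OF l t])
  also have "\<dots> = ennreal (3 ^ (2 * l) * ((L * exp L + 1) ^ (2 * l) * norm (g x) ^ (2 * l) * t ^ (4 * l)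
           + (L * exp L * K) ^ (2 * l) * c * t ^ (3 * l) + 0 * t ^ (3 * l)))"
  proof -
    have "(t\<^sup>2) ^ (2 * l) = t ^ (4 * l)"
      by (simp flip: power_mult)
    then show ?thesis
      by (simp add: power_mult_distrib ac_simps)
  qed
  also have "\<dots> \<le> ennreal (moment_const l * (1 + norm (g x) ^ (2 * l)) * t ^ (3 * l))"
  proof (intro ennreal_leI moment_bound_collect)
    show "3 ^ (2 * l) * ((L * exp L + 1) ^ (2 * l) + (L * exp L * K) ^ (2 * l) * c + 0) \<le> moment_const l"
      unfolding moment_const_def c_def using K_nonneg brownian_moment_const_nonneg by simp
  qed (use t L_nonneg K_nonneg c in auto)
  finally show ?thesis .
qed

lemma increment_moments_lyapunov:
  assumes l: "1 \<le> l" and a: "0 < a" and V: "\<And>y. a * (norm y)\<^sup>2 \<le> V y"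
  shows "\<exists>C>0. \<forall>x s \<eta>. 0 \<le> s \<and> s < 1 \<and> 0 < \<eta> \<and> \<eta> < 1 \<longrightarrow>
           (\<integral>\<^sup>+\<omega>. ennreal (norm (X x s \<omega> - x) ^ (2 * l)) \<partial>M)
              \<le> ennreal (C * (1 + V x ^ l) * s ^ l) \<and>
           (\<integral>\<^sup>+\<omega>. ennreal (norm (X x \<eta> \<omega> - (x + \<eta> *\<^sub>R g x + \<sigma> *v B \<eta> \<omega>)) ^ (2 * l)) \<partial>M)
              \<le> ennreal (C * (1 + V x ^ l) * \<eta> ^ (3 * l))"
proof -
  define Cg where "Cg = 1 + 2 ^ (2 * l) * (norm (g 0) ^ (2 * l) + L ^ (2 * l) / a ^ l)"
  have Cg: "0 < Cg"
    unfolding Cg_def using a L_nonneg by (simp add: add_pos_nonneg)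
  have weight: "moment_const l * (1 + norm (g x) ^ (2 * l)) * r \<le> moment_const l * Cg * (1 + V x ^ l) * r"
    if "0 \<le> r" for x r
    using mult_right_mono[OF mult_left_mono[OF lipschitz_power_growth_le[OF lip a V]] that]
      less_imp_le[OF moment_const_pos]
    unfolding Cg_def by (simp add: mult.assoc)
  show ?thesis
  proof (intro exI[of _ "moment_const l * Cg"] conjI allI impI)
    show "0 < moment_const l * Cg"
      using moment_const_pos Cg by simp
    fix x :: "real^'d" and s \<eta> :: real assume "0 \<le> s \<and> s < 1 \<and> 0 < \<eta> \<and> \<eta> < 1"
    then show "(\<integral>\<^sup>+\<omega>. ennreal (norm (X x s \<omega> - x) ^ (2 * l)) \<partial>M)
          \<le> ennreal (moment_const l * Cg * (1 + V x ^ l) * s ^ l)"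
      and "(\<integral>\<^sup>+\<omega>. ennreal (norm (X x \<eta> \<omega> - (x + \<eta> *\<^sub>R g x + \<sigma> *v B \<eta> \<omega>)) ^ (2 * l)) \<partial>M)
          \<le> ennreal (moment_const l * Cg * (1 + V x ^ l) * \<eta> ^ (3 * l))"
      by (auto intro!: order_trans[OF increment_moment_le[OF l]] order_trans[OF euler_error_moment_le[OF l]]
          ennreal_leI weight)
  qed
qed

end

theorem lemmaA3:
  fixes M :: "'a measure"
    and B :: "real \<Rightarrow> 'a \<Rightarrow> real^'d"
    and X :: "real^'d \<Rightarrow> real \<Rightarrow> 'a \<Rightarrow> real^'d"
    and \<alpha> \<beta> ca2 \<kappa> c2 :: real
    and p v :: "real^'d"
    and P \<sigma> Q :: "real^'d^'d"
  defines "R \<equiv> (mat 1 - transpose P) ** diagm v"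
  defines "\<gamma> \<equiv> matrix_inv R *v p"
  defines "g \<equiv> drift \<alpha> \<beta> p R"
  defines "V \<equiv> lyapV Q \<kappa> c2 p"
  assumes alpha: "\<alpha> > 0"
    and p_nonneg: "\<forall>i. p $ i \<ge> 0" and p_sum: "(\<Sum>i\<in>UNIV. p $ i) = 1"
    and v_pos: "\<forall>i. v $ i > 0"
    and P_nonneg: "\<forall>i j. P $ i $ j \<ge> 0"
    and P_substoch: "\<forall>i. (\<Sum>j\<in>UNIV. P $ i $ j) \<le> 1"
    and P_diag: "\<forall>i. P $ i $ i = 0"
    and IP_inv: "invertible (mat 1 - P)"
    and eRp: "onevec \<bullet> (matrix_inv R *v p) = 1"
    and ca2: "ca2 > 0"
    and sigma_cov: "\<sigma> ** transpose \<sigma> =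
          ca2 *\<^sub>R diagm p + H0 p + (\<Sum>k\<in>UNIV. (\<gamma> $ k * v $ k) *\<^sub>R Hk P k)
          + (mat 1 - transpose P) ** diagm v ** diagm \<gamma> ** (mat 1 - P)"
    and ellip: "\<exists>c>0. \<forall>\<xi>. \<xi> \<bullet> ((\<sigma> ** transpose \<sigma>) *v \<xi>) \<ge> c * (\<xi> \<bullet> \<xi>)"
    and Q_sym: "transpose Q = Q"
    and Q_pd: "\<forall>\<xi>. \<xi> \<noteq> 0 \<longrightarrow> \<xi> \<bullet> (Q *v \<xi>) > 0"
    and Q_norm: "(\<Sum>i\<in>UNIV. \<Sum>j\<in>UNIV. \<bar>Q $ i $ j\<bar>) = 1"
    and Q_lyap1: "\<forall>\<xi>. \<xi> \<noteq> 0 \<longrightarrow> \<xi> \<bullet> ((Q ** (- R) + transpose (- R) ** Q) *v \<xi>) < 0"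
    and Q_lyap2: "\<forall>\<xi>. \<xi> \<bullet> ((Q ** (- ((mat 1 - outerp p onevec) ** R))
                     + (- (transpose R ** (mat 1 - outerp onevec p))) ** Q) *v \<xi>) \<le> 0"
    and kappa: "\<kappa> > 0"
    and drift_cond: "\<exists>c1>0. \<exists>c1'. \<forall>y. generator g (\<sigma> ** transpose \<sigma>) (\<lambda>z. V z - c2) y
                        \<le> - c1 * (V y - c2) + c1'"
    and c2: "c2 > 0"
    and V_bounds: "\<exists>a1>0. \<exists>A1>0. \<exists>A2>0. \<forall>y.
                      a1 * (norm y)\<^sup>2 - c2 \<le> V y - c2 \<and> V y - c2 \<le> A1 * (norm y)\<^sup>2 + A2"
    and BM: "brownian_motion M B"
    and sol: "\<forall>x. solves_sde M g \<sigma> B x (X x)"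
  shows "\<forall>l::nat. l \<ge> 1 \<longrightarrow> (\<exists>C>0. \<forall>x s \<eta>. 0 \<le> s \<and> s < 1 \<and> 0 < \<eta> \<and> \<eta> < 1 \<longrightarrow>
           (\<integral>\<^sup>+\<omega>. ennreal (norm (X x s \<omega> - x) ^ (2 * l)) \<partial>M)
              \<le> ennreal (C * (1 + V x ^ l) * s ^ l) \<and>
           (\<integral>\<^sup>+\<omega>. ennreal (norm (X x \<eta> \<omega> - (x + \<eta> *\<^sub>R g x + \<sigma> *v B \<eta> \<omega>)) ^ (2 * l)) \<partial>M)
              \<le> ennreal (C * (1 + V x ^ l) * \<eta> ^ (3 * l)))"
proof -
  obtain a1 where a1: "0 < a1" and "\<forall>y. a1 * (norm y)\<^sup>2 - c2 \<le> V y - c2"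
    using V_bounds by blast
  then have V_lower: "a1 * (norm y)\<^sup>2 \<le> V y" for y
    by force
  let ?L = "onorm ((*v) R) + norm (onevec :: real^'d) * norm ((R - \<alpha> *\<^sub>R mat 1) *v p)"
  have lip: "?L-lipschitz_on UNIV g"
    unfolding g_def by (rule drift_lipschitz)
  interpret sde: lipschitz_additive_sde M B g \<sigma> X ?L "onorm ((*v) \<sigma>)"
    by unfold_locales (use BM sol lip in \<open>auto intro: onorm_pos_le onorm\<close>)
  show ?thesis
    using sde.increment_moments_lyapunov[OF _ a1 V_lower] by blast
qed

end
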